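(* Let $I_{SU(2)}(t)$ denote the $SU(2)$ BMN index at equal fugacities $a=b=c=t^2$, $|t|<1$ (the contour integral $I_{SU(N)}$ defined in the context, with $N=2$). Then $$I_{SU(2)}(t)=\frac{(1-t^2)^3\,P(t)}{(1-t^8)^3(1-t^{12})},$$ where $$P(t)=1+3t^2+12t^4+20t^6+42t^8+48t^{10}+75t^{12}+66t^{14}+81t^{16}+55t^{18}+54t^{20}+27t^{22}+19t^{24}+6t^{26}+3t^{28}.$$
   Context: For $N\ge 2$ and complex fugacities $|a|,|b|,|c|<1$, the BMN index of $SU(N)$ $\mathcal N=4$ SYM is $$I_{SU(N)}=\frac{\kappa^{N-1}}{N!}\oint_{|z_1|=1}\cdots\oint_{|z_N|=1}\ \prod_{i=1}^N\frac{dz_i}{2\pi i z_i}\ \prod_{\substack{1\le i,j\le N\\ i\ne j}}\frac{\left(1-\frac{z_i}{z_j}\right)\left(1-ab\frac{z_i}{z_j}\right)\left(1-bc\frac{z_i}{z_j}\right)\left(1-ca\frac{z_i}{z_j}\right)}{\left(1-abc\frac{z_i}{z_j}\right)\left(1-a\frac{z_i}{z_j}\right)\left(1-b\frac{z_i}{z_j}\right)\left(1-c\frac{z_i}{z_j}\right)},$$ with $$\kappa=\frac{(1-ab)(1-bc)(1-ca)}{(1-abc)(1-a)(1-b)(1-c)}.$$ All contours are unit circles, oriented counterclockwise. *)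

theory Defs
  imports "HOL-Complex_Analysis.Complex_Analysis"
begin

text \<open>
  Iterated integral over counterclockwise unit circles in the variables \<open>z i\<close>, for \<open>i\<close> in the
  given list of indices; the head of the list is the outermost integration. The argument \<open>z\<close>
  supplies the values of the variables that are not integrated over.
\<close>

primrec circle_integrals ::
  "nat list \<Rightarrow> ((nat \<Rightarrow> complex) \<Rightarrow> complex) \<Rightarrow> (nat \<Rightarrow> complex) \<Rightarrow> complex" where
  "circle_integrals [] f z = f z"
| "circle_integrals (i # is) f z =
     contour_integral (circlepath 0 1) (\<lambda>w. circle_integrals is f (z(i := w)))"

definition bmn_kappa :: "complex \<Rightarrow> complex \<Rightarrow> complex \<Rightarrow> complex" where
  "bmn_kappa a b c =
     ((1 - a * b) * (1 - b * c) * (1 - c * a)) /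
     ((1 - a * b * c) * (1 - a) * (1 - b) * (1 - c))"

definition bmn_factor :: "complex \<Rightarrow> complex \<Rightarrow> complex \<Rightarrow> complex \<Rightarrow> complex" where
  "bmn_factor a b c u =
     ((1 - u) * (1 - a * b * u) * (1 - b * c * u) * (1 - c * a * u)) /
     ((1 - a * b * c * u) * (1 - a * u) * (1 - b * u) * (1 - c * u))"

definition bmn_integrand ::
  "nat \<Rightarrow> complex \<Rightarrow> complex \<Rightarrow> complex \<Rightarrow> (nat \<Rightarrow> complex) \<Rightarrow> complex" where
  "bmn_integrand N a b c z =
     (\<Prod>i\<in>{1..N}. 1 / (2 * of_real pi * \<i> * z i)) *
     (\<Prod>(i, j)\<in>{(i, j). i \<in> {1..N} \<and> j \<in> {1..N} \<and> i \<noteq> j}. bmn_factor a b c (z i / z j))"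

text \<open>
  The index is meant for \<open>N \<ge> 2\<close> and fugacities of modulus less than 1, where the integrand has
  no pole on the torus. The base point \<open>\<lambda>_. 0\<close> is irrelevant: the integrand only
  depends on \<open>z 1, \<dots>, z N\<close>, all of which are integrated over.
\<close>

definition bmn_index :: "nat \<Rightarrow> complex \<Rightarrow> complex \<Rightarrow> complex \<Rightarrow> complex" where
  "bmn_index N a b c =
     bmn_kappa a b c ^ (N - 1) / fact N *
     circle_integrals [1..<Suc N] (bmn_integrand N a b c) (\<lambda>_. 0)"

end

(*
  By scale invariance the inner integral is, up to constants, the mean over the unit circle of
  F(u) F(1/u), where u = z1/z2 and x = t^2. This function is rational in u + 1/u, hence in
  q = (1 - x u)(1 - x/u). Expand it in partial fractions 1, 1/r, 1/q, 1/q^2, 1/q^3 with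
  r = (1 - x^3 u)(1 - x^3/u); the circle means of these are elementary, and summing them leaves a
  polynomial identity in x. At x = 0 the poles escape to infinity, so this case is separate.
*)
theory Submission
  imports Defs
begin

section \<open>Means over the unit circle\<close>

text \<open>The measure is \<open>dz / (2 pi i z)\<close>, so a constant is its own mean. Building
  on \<open>has_contour_integral\<close> carries integrability along with the value.\<close>

definition has_circle_mean :: "(complex \<Rightarrow> complex) \<Rightarrow> complex \<Rightarrow> bool" where
  "has_circle_mean f c \<longleftrightarrow>
     ((\<lambda>z. f z / z) has_contour_integral (2 * of_real pi * \<i> * c)) (circlepath 0 1)"

lemma has_circle_mean_cong:
  assumes "has_circle_mean f c" "\<And>z. norm z = 1 \<Longrightarrow> f z = g z" "c = d"
  shows "has_circle_mean g d"
  using assms unfolding has_circle_mean_def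
  by (auto intro: has_contour_integral_eq)

lemma has_circle_mean_add:
  assumes "has_circle_mean f c" "has_circle_mean g d"
  shows "has_circle_mean (\<lambda>z. f z + g z) (c + d)"
  using has_contour_integral_add[OF assms[unfolded has_circle_mean_def]]
  by (simp add: has_circle_mean_def add_divide_distrib algebra_simps)

lemma has_circle_mean_cmult:
  assumes "has_circle_mean f c"
  shows "has_circle_mean (\<lambda>z. k * f z) (k * c)"
  using has_contour_integral_lmul[OF assms[unfolded has_circle_mean_def], of k]
  by (simp add: has_circle_mean_def algebra_simps)

lemma has_circle_mean_holomorphic:
  assumes "f holomorphic_on cball 0 1"
  shows "has_circle_mean f (f 0)"
  using Cauchy_integral_circlepath_simple[OF assms, of 0]
  by (simp add: has_circle_mean_def)

lemma has_circle_mean_const: "has_circle_mean (\<lambda>z. k) k"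
  by (rule has_circle_mean_holomorphic) auto

lemma one_minus_mult_nonzero:
  fixes a z :: complex
  assumes "norm a < 1" "norm z \<le> 1"
  shows "1 - a * z \<noteq> 0"
proof
  assume "1 - a * z = 0"
  hence "norm (a * z) = 1" by simp
  moreover have "norm (a * z) \<le> norm a * 1"
    unfolding norm_mult by (intro mult_left_mono assms) simp
  ultimately show False using assms by simp
qed

lemma has_circle_mean_geometric:
  assumes "norm a < 1"
  shows "has_circle_mean (\<lambda>z. 1 / (1 - a * z) ^ k) 1"
proof -
  have "(\<lambda>z. 1 / (1 - a * z) ^ k) holomorphic_on cball 0 1"
    by (intro holomorphic_intros) (use one_minus_mult_nonzero[OF assms] in auto)
  from has_circle_mean_holomorphic[OF this] show ?thesis by simp
qed

text \<open>Here the pole lies inside the circle. With \<open>k = m + 1\<close> the integrand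
  becomes \<open>z ^ m / (z - a) ^ Suc m\<close>, and Cauchy's formula yields the
  \<open>m\<close>-th derivative of \<open>z ^ m\<close>, which cancels
  \<open>fact m\<close>.\<close>

lemma has_circle_mean_geometric_inverse:
  assumes "norm a < 1"
  shows "has_circle_mean (\<lambda>z. 1 / (1 - a / z) ^ k) 1"
proof (cases k)
  case 0
  then show ?thesis using has_circle_mean_const[of 1] by simp
next
  case (Suc m)
  have "((\<lambda>z. z ^ m / (z - a) ^ Suc m) has_contour_integral
          ((2 * pi * \<i>) / fact m * (deriv ^^ m) (\<lambda>z. z ^ m) a)) (circlepath 0 1)"
    by (rule Cauchy_has_contour_integral_higher_derivative_circlepath)
       (use assms in \<open>auto intro!: holomorphic_intros continuous_intros\<close>)
  moreover have "(deriv ^^ m) (\<lambda>z. z ^ m) a = fact m"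
    using higher_deriv_power[of m 0 m a] by (simp add: pochhammer_fact)
  ultimately have
    "((\<lambda>z. z ^ m / (z - a) ^ Suc m) has_contour_integral (2 * pi * \<i>)) (circlepath 0 1)"
    by simp
  moreover have "z ^ m / (z - a) ^ Suc m = 1 / (1 - a / z) ^ k / z" if "norm z = 1" for z
  proof -
    have "z \<noteq> 0" using that by auto
    moreover from this have "1 - a / z = (z - a) / z" by (simp add: field_simps)
    ultimately show ?thesis using Suc by (simp add: power_divide)
  qed
  ultimately show ?thesis
    unfolding has_circle_mean_def by (auto intro: has_contour_integral_eq)
qed

text \<open>Every power of \<open>A\<close> and of \<open>B\<close> has mean 1, so the mean is just
  the sum of the coefficients.\<close>

lemma has_circle_mean_lincomb:
  assumes "norm a < 1" "norm b < 1"
  defines "A \<equiv> \<lambda>z. 1 / (1 - a * z)" and "B \<equiv> \<lambda>z. 1 / (1 - b / z)"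
  shows "has_circle_mean
    (\<lambda>z. c0 + (c1 * A z + (c2 * A z ^ 2 + (c3 * A z ^ 3 +
          (d1 * B z + (d2 * B z ^ 2 + d3 * B z ^ 3))))))
    (c0 + (c1 + (c2 + (c3 + (d1 + (d2 + d3))))))"
proof -
  have A: "has_circle_mean (\<lambda>z. k * A z ^ n) k" for k n
    using has_circle_mean_cmult[OF has_circle_mean_geometric[OF assms(1), of n], of k]
    by (simp add: A_def power_divide)
  have B: "has_circle_mean (\<lambda>z. k * B z ^ n) k" for k n
    using has_circle_mean_cmult[OF has_circle_mean_geometric_inverse[OF assms(2), of n], of k]
    by (simp add: B_def power_divide)
  from A[of _ 1] B[of _ 1] show ?thesis
    by (intro has_circle_mean_add has_circle_mean_const A B) auto
qed

text \<open>
  The means rest on \<open>A B = (A + B - 1) / (1 - a b)\<close> for \<open>A = 1 / (1 - a z)\<close> and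
  \<open>B = 1 / (1 - b / z)\<close>, which reduces any product of powers to a sum of pure powers.
\<close>

lemma has_circle_mean_kernel:
  assumes "norm a < 1" "norm b < 1"
  defines "Q \<equiv> \<lambda>z. (1 - a * z) * (1 - b / z)"
  shows "has_circle_mean (\<lambda>z. 1 / Q z) (1 / (1 - a * b))"
    and "has_circle_mean (\<lambda>z. 1 / Q z ^ 2) ((1 + a * b) / (1 - a * b) ^ 3)"
    and "has_circle_mean (\<lambda>z. 1 / Q z ^ 3)
           ((1 + 4 * (a * b) + (a * b)\<^sup>2) / (1 - a * b) ^ 5)"
proof -
  define A where "A = (\<lambda>z. 1 / (1 - a * z))"
  define B where "B = (\<lambda>z. 1 / (1 - b / z))"
  define m where "m = 1 / (1 - a * b)"
  have mean: "has_circle_mean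
    (\<lambda>z. c0 + (c1 * A z + (c2 * A z ^ 2 + (c3 * A z ^ 3 +
          (d1 * B z + (d2 * B z ^ 2 + d3 * B z ^ 3))))))
    (c0 + (c1 + (c2 + (c3 + (d1 + (d2 + d3))))))" for c0 c1 c2 c3 d1 d2 d3
    unfolding A_def B_def by (rule has_circle_mean_lincomb[OF assms(1,2)])
  have ab: "1 - a * b \<noteq> 0" using one_minus_mult_nonzero[of a b] assms by simp
  have AB: "A z * B z = m * (A z + B z - 1)" and Q: "1 / Q z = A z * B z"
    if "norm z = 1" for z
  proof -
    have z: "z \<noteq> 0" using that by auto
    have "1 - a * z \<noteq> 0" using one_minus_mult_nonzero assms that by simp
    moreover have "1 - b / z \<noteq> 0"
      using one_minus_mult_nonzero[of b "1 / z"] assms that by (simp add: norm_divide)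
    hence "z - b \<noteq> 0" using z by auto
    moreover have "1 - b / z = (z - b) / z" using z by (simp add: field_simps)
    ultimately show "A z * B z = m * (A z + B z - 1)"
      using z ab unfolding A_def B_def m_def by (simp add: divide_simps) algebra
    show "1 / Q z = A z * B z" by (simp add: Q_def A_def B_def)
  qed
  show "has_circle_mean (\<lambda>z. 1 / Q z) (1 / (1 - a * b))"
  proof (rule has_circle_mean_cong[OF mean[of "-m" m 0 0 m 0 0]], goal_cases)
    case (1 z)
    show ?case using AB[OF 1] Q[OF 1] by algebra
  qed (simp add: m_def)
  show "has_circle_mean (\<lambda>z. 1 / Q z ^ 2) ((1 + a * b) / (1 - a * b) ^ 3)"
  \<comment> \<open>Square \<open>A B = m (A + B - 1)\<close> and replace the mixed term
    \<open>2 A B\<close> by \<open>2 m (A + B - 1)\<close>. The coefficients add up to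
    \<open>m^2 * (2 * m - 1)\<close>.\<close>
  proof (rule has_circle_mean_cong[OF mean[of "m^2 * (1 - 2 * m)" "m^2 * (2 * m - 2)" "m^2" 0
          "m^2 * (2 * m - 2)" "m^2" 0]], goal_cases)
    case (1 z)
    have "1 / Q z ^ 2 = (A z * B z) ^ 2"
      using Q[OF 1] by (simp add: power_one_over[symmetric])
    thus ?case using AB[OF 1] by algebra
  next
    case 2
    show ?case using ab unfolding m_def by (simp add: divide_simps) algebra
  qed
  show "has_circle_mean (\<lambda>z. 1 / Q z ^ 3)
           ((1 + 4 * (a * b) + (a * b)\<^sup>2) / (1 - a * b) ^ 5)"
  \<comment> \<open>Likewise from the cube of \<open>m (A + B - 1)\<close>, with the mixed terms
    reduced repeatedly by the same relation.\<close>
  proof (rule has_circle_mean_cong[OF mean[of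
          "m^3 * (6 * m - 6 * m^2 - 1)" "m^3 * (6 * m^2 - 9 * m + 3)" "m^3 * (3 * m - 3)" "m^3"
          "m^3 * (6 * m^2 - 9 * m + 3)" "m^3 * (3 * m - 3)" "m^3"]], goal_cases)
    case (1 z)
    have "1 / Q z ^ 3 = (A z * B z) ^ 3"
      using Q[OF 1] by (simp add: power_one_over[symmetric])
    thus ?case using AB[OF 1] by algebra
  next
    case 2
    show ?case using ab unfolding m_def by (simp add: divide_simps) algebra
  qed
qed

section \<open>The partial fraction decomposition\<close>

text \<open>
  For \<open>a = b = c = x\<close> the product of the two factors is a rational function of
  \<open>q = (1 - x u) (1 - x / u)\<close>, with a triple pole at \<open>q = 0\<close> and a simple pole where
  \<open>r = (1 - x\<^sup>3 u) (1 - x\<^sup>3 / u) = (1 - x\<^sup>2) (1 - x\<^sup>4) + x\<^sup>2 q\<close> vanishes. Below, \<open>coeff0 x\<close> is the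
  coefficient of \<open>1 / r\<close>, and those of \<open>1 / q\<close>, \<open>1 / q\<^sup>2\<close>, \<open>1 / q\<^sup>3\<close> are \<open>coeff1 x / x\<close>,
  \<open>coeff2 x / x\<close>, \<open>coeff3 x / x\<close>.
\<close>

definition coeff3 :: "complex \<Rightarrow> complex" where
  "coeff3 x = - ((1 - x)^6 * (1 + x + x^2)^3) / ((1 + x)^2 * (1 + x^2))"

definition coeff2 :: "complex \<Rightarrow> complex" where
  "coeff2 x = (1 - x)^4 * (1 + x + x^2)^2 *
     ((1 - x)^2 * ((1 + x)^2 * (1 + x^2)) + x^2 * (1 + x + x^2)) / ((1 + x)^2 * (1 + x^2))^2"

definition coeff1 :: "complex \<Rightarrow> complex" where
  "coeff1 x = (1 - x)^2 * (1 + x + x^2) *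
     (3 * x * (1 + x^2) * ((1 + x)^2 * (1 + x^2))^2 - x^2 * (1 + x + x^2) *
       ((1 - x)^2 * ((1 + x)^2 * (1 + x^2)) + x^2 * (1 + x + x^2))) / ((1 + x)^2 * (1 + x^2))^3"

definition coeff0 :: "complex \<Rightarrow> complex" where
  "coeff0 x = 3 * (1 - x)^2 * (1 + x + x^2) * x - (1 - x)^2 * x^2 - x * coeff1 x
     - (1 - x)^2 * ((1 + x)^2 * (1 + x^2))"

text \<open>The assumptions on \<open>d0\<close>, \<open>d1\<close>, \<open>d2\<close> compare
  coefficients of \<open>q^0\<close>, \<open>q^1\<close>, \<open>q^2\<close> in the cleared
  equation: these are the Taylor coefficients at \<open>q = 0\<close> of the numerator over
  \<open>g + x^2 * q\<close>. The constant 1 is the ratio of the leading coefficients, both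
  \<open>x^3\<close>.\<close>

lemma partial_fractions_aux:
  fixes x q g e f d0 d1 d2 :: complex
  assumes "x \<noteq> 0" "q \<noteq> 0" "g + x^2 * q \<noteq> 0"
    and "g * d0 = - e * f^3"
    and "g * d1 = f^3 - 3 * e * f^2 * x - x^2 * d0"
    and "g * d2 = 3 * f^2 * x - 3 * e * f * x^2 - x^2 * d1"
  shows "(q - e) * (f + x * q)^3 / (x * (g + x^2 * q) * q^3) =
    1 + (3 * f * x - e * x^2 - x * d2 - g) / (g + x^2 * q)
      + d2 / x / q + d1 / x / q^2 + d0 / x / q^3"
proof -
  \<comment> \<open>A free \<open>r\<close> keeps the denominator \<open>g + x^2 * q\<close> atomic
    while fractions are combined.\<close>
  have "1 + (3 * f * x - e * x^2 - x * d2 - g) / r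
      + d2 / x / q + d1 / x / q^2 + d0 / x / q^3 =
      (x * r * q^3 + x * (3 * f * x - e * x^2 - x * d2 - g) * q^3 + d2 * r * q^2 + d1 * r * q
        + d0 * r) / (x * r * q^3)" if "r \<noteq> 0" for r
    using assms(1,2) that by (simp add: divide_simps) algebra
  moreover have "(q - e) * (f + x * q)^3 =
      x * (g + x^2 * q) * q^3 + x * (3 * f * x - e * x^2 - x * d2 - g) * q^3
        + d2 * (g + x^2 * q) * q^2 + d1 * (g + x^2 * q) * q + d0 * (g + x^2 * q)"
    using assms(4-6) by algebra
  ultimately show ?thesis using assms(3) by simp
qed

lemma one_minus_power_nonzero:
  fixes x :: complex
  assumes "norm x < 1" "n > 0"
  shows "1 - x ^ n \<noteq> 0"
  using one_minus_mult_nonzero[of "x ^ n" 1] assms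
  by (simp add: norm_power power_less_one_iff)

lemma coeff_denom_nonzero:
  fixes x :: complex
  assumes "norm x < 1"
  shows "1 - x \<noteq> 0" "1 + x \<noteq> 0" "1 + x^2 \<noteq> 0" "1 + x + x^2 \<noteq> 0" "1 - x + x^2 \<noteq> 0"
proof -
  have "1 - x^6 = (1 - x) * (1 + x) * (1 + x + x^2) * (1 - x + x^2)" by algebra
  moreover have "1 - x^4 = (1 - x^2) * (1 + x^2)" by algebra
  ultimately show "1 - x \<noteq> 0" "1 + x \<noteq> 0" "1 + x^2 \<noteq> 0" "1 + x + x^2 \<noteq> 0"
      "1 - x + x^2 \<noteq> 0"
    using one_minus_power_nonzero[OF assms, of 6] one_minus_power_nonzero[OF assms, of 4] by auto
qed

text \<open>Pairing each factor at \<open>u\<close> with its partner at \<open>1 / u\<close> gives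
  something affine in \<open>u + 1 / u\<close>, hence in \<open>q\<close>.\<close>

lemma bmn_factor_decomposition:
  fixes x u :: complex
  assumes x: "norm x < 1" "x \<noteq> 0" and u: "norm u = 1"
  defines "q \<equiv> (1 - x * u) * (1 - x / u)" and "r \<equiv> (1 - x^3 * u) * (1 - x^3 / u)"
  shows "bmn_factor x x x u * bmn_factor x x x (1 / u) =
    1 + coeff0 x / r + coeff1 x / x / q + coeff2 x / x / q^2 + coeff3 x / x / q^3"
proof -
  define g where "g = (1 - x)^2 * ((1 + x)^2 * (1 + x^2))"
  define e where "e = (1 - x)^2"
  define f where "f = (1 - x)^2 * (1 + x + x^2)"
  have u0: "u \<noteq> 0" using u by auto
  note ne = one_minus_mult_nonzero
  have x3: "norm (x^3) < 1" using x by (simp add: norm_power power_less_one_iff)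
  have q0: "q \<noteq> 0"
    using ne[OF x(1), of u] ne[OF x(1), of "1 / u"] u by (simp add: q_def norm_divide)
  have r0: "r \<noteq> 0"
    using ne[OF x3, of u] ne[OF x3, of "1 / u"] u by (simp add: r_def norm_divide)
  \<comment> \<open>With \<open>u * y = 1\<close> as a side relation, the identities below become
    polynomial ones.\<close>
  define y where "y = 1 / u"
  have uy: "u * y = 1" using u0 by (simp add: y_def)
  have rq: "r = g + x^2 * q"
    using uy unfolding r_def q_def g_def by (simp add: y_def divide_inverse) algebra
  have n1: "x * ((1 - u) * (1 - 1 / u)) = q - e"
    using uy unfolding q_def e_def by (simp add: y_def divide_inverse) algebra
  have n2: "(1 - x * x * u) * (1 - x * x * (1 / u)) = f + x * q"
    using uy unfolding q_def f_def by (simp add: y_def divide_inverse) algebra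
  have "bmn_factor x x x u * bmn_factor x x x (1 / u) =
      ((1 - u) * (1 - 1 / u)) * ((1 - x * x * u) * (1 - x * x * (1 / u)))^3 / (r * q^3)"
    unfolding bmn_factor_def q_def r_def
    by (simp add: power3_eq_cube mult_ac)
  also have "\<dots> = (x * ((1 - u) * (1 - 1 / u))) * ((1 - x * x * u) * (1 - x * x * (1 / u)))^3
      / (x * r * q^3)"
    using x(2) by simp
  also have "\<dots> = (q - e) * (f + x * q)^3 / (x * (g + x^2 * q) * q^3)"
    unfolding n1 n2 rq ..
  also have "\<dots> = 1 + (3 * f * x - e * x^2 - x * coeff1 x - g) / (g + x^2 * q)
      + coeff1 x / x / q + coeff2 x / x / q^2 + coeff3 x / x / q^3"
  proof (rule partial_fractions_aux[OF x(2) q0 r0[unfolded rq]])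
    define v where "v = (1 + x)^2 * (1 + x^2)"
    have v0: "v \<noteq> 0" using coeff_denom_nonzero[OF x(1)] by (simp add: v_def)
    have v: "v = (1 + x)^2 * (1 + x^2)" by (fact v_def)
    have c3: "v * coeff3 x = - ((1 - x)^6 * (1 + x + x^2)^3)"
      using v0 unfolding coeff3_def v_def[symmetric] by simp
    have c2: "v^2 * coeff2 x = (1 - x)^4 * (1 + x + x^2)^2 *
        ((1 - x)^2 * v + x^2 * (1 + x + x^2))"
      using v0 unfolding coeff2_def v_def[symmetric] by simp
    show "g * coeff3 x = - e * f^3"
      using c3 unfolding g_def e_def f_def v_def[symmetric] by algebra
    \<comment> \<open>The denominator of \<open>coeff2\<close> is \<open>v^2\<close> but
      \<open>g\<close> supplies only one \<open>v\<close>; the extra factor clears the rest. For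
      \<open>coeff1\<close> it is \<open>v^2\<close>.\<close>
    have "v * (g * coeff2 x) = v * (f^3 - 3 * e * f^2 * x - x^2 * coeff3 x)"
      using c2 c3 v unfolding g_def e_def f_def v_def[symmetric] by algebra
    thus "g * coeff2 x = f^3 - 3 * e * f^2 * x - x^2 * coeff3 x"
      using v0 by simp
    have c1: "v^3 * coeff1 x = (1 - x)^2 * (1 + x + x^2) *
       (3 * x * (1 + x^2) * v^2 - x^2 * (1 + x + x^2) *
       ((1 - x)^2 * v + x^2 * (1 + x + x^2)))"
      using v0 unfolding coeff1_def v_def[symmetric] by simp
    have "v^2 * (g * coeff1 x) = v^2 * (3 * f^2 * x - 3 * e * f * x^2 - x^2 * coeff2 x)"
      using c1 c2 v unfolding g_def e_def f_def v_def[symmetric] by algebra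
    thus "g * coeff1 x = 3 * f^2 * x - 3 * e * f * x^2 - x^2 * coeff2 x"
      using v0 by simp
  qed
  finally show ?thesis
    unfolding rq[symmetric] by (simp add: coeff0_def e_def f_def g_def mult_ac)
qed

text \<open>The kernel means are applied with \<open>a = y / w\<close> and \<open>b = y * w\<close>,
  for \<open>y = x\<close> and \<open>y = x^3\<close>. They depend only on
  \<open>a * b = y^2\<close>, so \<open>w\<close> drops out.\<close>

lemma has_circle_mean_bmn_factor:
  fixes x w :: complex
  assumes x: "norm x < 1" "x \<noteq> 0" and w: "norm w = 1"
  shows "has_circle_mean (\<lambda>z. bmn_factor x x x (w / z) * bmn_factor x x x (z / w))
    (1 + coeff0 x / (1 - x^6) + coeff1 x / x / (1 - x^2)
       + coeff2 x / x * (1 + x^2) / (1 - x^2)^3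
       + coeff3 x / x * (1 + 4 * x^2 + x^4) / (1 - x^2)^5)"
proof -
  define Q where "Q = (\<lambda>y z. (1 - y / w * z) * (1 - y * w / z))"
  have w0: "w \<noteq> 0" using w by auto
  have x3: "norm (x^3) < 1" using x by (simp add: norm_power power_less_one_iff)
  have yw: "norm (y / w) < 1" "norm (y * w) < 1" "y / w * (y * w) = y^2"
    if "norm y < 1" for y
    using that w w0 by (simp_all add: norm_divide norm_mult power2_eq_square)
  note mean = has_circle_mean_kernel[OF yw(1,2)[OF x(1)], unfolded yw(3)[OF x(1)], folded Q_def]
  note mean3 = has_circle_mean_kernel(1)[OF yw(1,2)[OF x3], unfolded yw(3)[OF x3], folded Q_def]
  have "has_circle_mean (\<lambda>z. 1 + coeff0 x * (1 / Q (x^3) z) + coeff1 x / x * (1 / Q x z)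
      + coeff2 x / x * (1 / Q x z ^ 2) + coeff3 x / x * (1 / Q x z ^ 3))
    (1 + coeff0 x * (1 / (1 - (x^3)^2)) + coeff1 x / x * (1 / (1 - x^2))
       + coeff2 x / x * ((1 + x^2) / (1 - x^2)^3)
       + coeff3 x / x * ((1 + 4 * x^2 + (x^2)^2) / (1 - x^2)^5))"
    using mean mean3 unfolding Q_def
    by (intro has_circle_mean_add has_circle_mean_cmult has_circle_mean_const) auto
  then show ?thesis
  proof (rule has_circle_mean_cong, goal_cases)
    case (1 z)
    hence z0: "z \<noteq> 0" by auto
    have Qeq: "Q y z = (1 - y * (w / z)) * (1 - y / (w / z))" for y
      using z0 w0 by (simp add: Q_def field_simps)
    show ?case
      using bmn_factor_decomposition[OF x, of "w / z"] 1 w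
      unfolding Qeq[symmetric] by (simp add: norm_divide)
  next
    case 2
    show ?case by (simp flip: power_mult)
  qed
qed

text \<open>The product collapses to \<open>2 - w / z - z / w\<close>, whose last two terms have
  mean 0.\<close>

lemma has_circle_mean_bmn_factor_zero:
  fixes w :: complex
  assumes w: "norm w = 1"
  shows "has_circle_mean (\<lambda>z. bmn_factor 0 0 0 (w / z) * bmn_factor 0 0 0 (z / w)) 2"
proof -
  have "((\<lambda>z. (1 :: complex) / (z - 0) ^ Suc 1) has_contour_integral
          ((2 * pi * \<i>) / fact 1 * (deriv ^^ 1) (\<lambda>_. 1) 0)) (circlepath 0 1)"
    by (rule Cauchy_has_contour_integral_higher_derivative_circlepath) auto
  hence "has_circle_mean (\<lambda>z. 1 / z) 0"
    by (simp add: has_circle_mean_def power2_eq_square)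
  moreover have "has_circle_mean (\<lambda>z. z) 0"
    using has_circle_mean_holomorphic[of "\<lambda>z. z"] by simp
  ultimately have "has_circle_mean (\<lambda>z. 2 + (- w) * (1 / z) + (- 1 / w) * z)
      (2 + (- w) * 0 + (- 1 / w) * 0)"
    by (intro has_circle_mean_add has_circle_mean_cmult has_circle_mean_const)
  then show ?thesis
  proof (rule has_circle_mean_cong, goal_cases)
    case (1 z)
    hence "z \<noteq> 0" "w \<noteq> 0" using w by auto
    thus ?case by (simp add: bmn_factor_def field_simps)
  qed simp
qed

section \<open>The index\<close>

text \<open>As the inner mean \<open>C\<close> is the same for every \<open>w\<close> on the circle,
  the outer integral averages a constant. The 2 is \<open>fact 2\<close>.\<close>

lemma bmn_index_2_eq:
  assumes "\<And>w. norm w = 1 \<Longrightarrow>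
    has_circle_mean (\<lambda>z. bmn_factor a b c (w / z) * bmn_factor a b c (z / w)) C"
  shows "bmn_index 2 a b c = bmn_kappa a b c / 2 * C"
proof -
  define k where "k = 1 / (2 * of_real pi * \<i> :: complex)"
  have k: "k * (2 * of_real pi * \<i>) = 1" by (simp add: k_def)
  have pairs: "{(i, j). i \<in> {1..2} \<and> j \<in> {1..2} \<and> i \<noteq> j} = {(1, 2), (2, 1 :: nat)}"
    by auto
  have range: "{1..2 :: nat} = {1, 2}" by auto
  have list: "[1..<Suc 2] = [1, 2]" by (simp add: upt_rec)
  have integrand: "bmn_integrand 2 a b c (z(1 := w, 2 := v)) =
      k * k / w * ((bmn_factor a b c (w / v) * bmn_factor a b c (v / w)) / v)" for z w v
    unfolding bmn_integrand_def pairs unfolding range by (simp add: k_def)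
  have inner: "contour_integral (circlepath 0 1)
      (\<lambda>v. bmn_integrand 2 a b c (z(1 := w, 2 := v))) = (k * C) / w" if "norm w = 1" for z w
  proof -
    have "((\<lambda>v. bmn_integrand 2 a b c (z(1 := w, 2 := v))) has_contour_integral
        (k * k / w * (2 * of_real pi * \<i> * C))) (circlepath 0 1)"
      unfolding integrand
      by (rule has_contour_integral_lmul, rule assms[OF that, unfolded has_circle_mean_def])
    moreover have "k * k / w * (2 * of_real pi * \<i> * C) = (k * C) / w"
      using k by (simp add: field_simps)
    ultimately show ?thesis by (metis contour_integral_unique)
  qed
  have "((\<lambda>w. contour_integral (circlepath 0 1)
      (\<lambda>v. bmn_integrand 2 a b c ((\<lambda>_. 0)(1 := w, 2 := v)))) has_contour_integral
      (2 * of_real pi * \<i> * (k * C))) (circlepath 0 1)"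
    by (rule has_contour_integral_eq[OF has_circle_mean_const[unfolded has_circle_mean_def]])
       (simp_all add: inner del: One_nat_def)
  moreover have "2 * of_real pi * \<i> * (k * C) = C" using k by (simp add: mult_ac)
  ultimately have "circle_integrals [1, 2] (bmn_integrand 2 a b c) (\<lambda>_. 0) = C"
    using contour_integral_unique by force
  thus ?thesis unfolding bmn_index_def list by simp
qed

lemma index_rational_identity:
  fixes x :: complex
  assumes x: "norm x < 1" "x \<noteq> 0"
  shows "bmn_kappa x x x / 2 *
    (1 + coeff0 x / (1 - x^6) + coeff1 x / x / (1 - x^2)
       + coeff2 x / x * (1 + x^2) / (1 - x^2)^3
       + coeff3 x / x * (1 + 4 * x^2 + x^4) / (1 - x^2)^5) =
    (1 - x)^3 *
    (1 + 3*x + 12*x^2 + 20*x^3 + 42*x^4 + 48*x^5 + 75*x^6 + 66*x^7 + 81*x^8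
       + 55*x^9 + 54*x^10 + 27*x^11 + 19*x^12 + 6*x^13 + 3*x^14) /
    ((1 - x^4)^3 * (1 - x^6))"
proof -
  \<comment> \<open>Up to sign, \<open>m\<close>, \<open>p\<close>, \<open>s\<close>,
    \<open>h\<close>, \<open>r\<close> are the cyclotomic polynomials of orders 1, 2, 3, 4, 6. All
    denominators are products of these and \<open>x\<close>.\<close>
  define m where "m = 1 - x"
  define p where "p = 1 + x"
  define h where "h = 1 + x^2"
  define s where "s = 1 + x + x^2"
  define r where "r = 1 - x + x^2"
  define W where "W = m^2 * p^2 * h + x^2 * s"
  note defs = m_def p_def h_def s_def r_def
  have nz: "m \<noteq> 0" "p \<noteq> 0" "h \<noteq> 0" "s \<noteq> 0" "r \<noteq> 0"
    using coeff_denom_nonzero[OF x(1)] by (simp_all add: defs)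
  have e2: "1 - x^2 = m * p" and e3: "1 - x^3 = m * s" and e4: "1 - x^4 = m * p * h"
    and e6: "1 - x^6 = m * p * s * r"
    unfolding defs by algebra+
  have t3: "coeff3 x / x * (1 + 4 * x^2 + x^4) / (1 - x^2)^5 =
      - (m * s^3 * (1 + 4 * x^2 + x^4)) / (x * p^7 * h)"
    unfolding coeff3_def e2 s_def[symmetric]
    unfolding m_def[symmetric] p_def[symmetric] h_def[symmetric]
    using nz x(2) by (simp add: divide_simps, intro disjI2, simp add: eval_nat_numeral)
  have t2: "coeff2 x / x * (1 + x^2) / (1 - x^2)^3 = m * s^2 * W / (x * p^7 * h)"
    unfolding coeff2_def e2 W_def s_def[symmetric]
    unfolding m_def[symmetric] p_def[symmetric] h_def[symmetric]
    using nz x(2) by (simp add: divide_simps) algebra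
  \<comment> \<open>What remains of the numerator of \<open>coeff1\<close> after extracting
    \<open>x * m^2 * s\<close>; the \<open>x\<close> cancels in \<open>coeff1 x / x\<close>.\<close>
  define c1 where "c1 = 3 * p^4 * h^3 - x * s * W"
  have c1: "coeff1 x = x * m^2 * s * c1 / (p^6 * h^3)"
    unfolding coeff1_def c1_def W_def s_def[symmetric]
    unfolding m_def[symmetric] p_def[symmetric] h_def[symmetric]
    using nz x(2) by (simp add: divide_simps) algebra
  have t1: "coeff1 x / x / (1 - x^2) = m * s * c1 / (p^7 * h^3)"
    unfolding c1 e2 using nz x(2) by (simp add: divide_simps) algebra
  have t0: "coeff0 x / (1 - x^6) =
      m * (3 * s * x - x^2 - p^2 * h) / (p * s * r) - x^2 * m * c1 / (p^7 * h^3 * r)"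
    unfolding coeff0_def c1 e6 s_def[symmetric]
    unfolding m_def[symmetric] p_def[symmetric] h_def[symmetric]
    using nz x(2) by (simp add: divide_simps) algebra
  define P where "P = 1 + 3*x + 12*x^2 + 20*x^3 + 42*x^4 + 48*x^5 + 75*x^6 + 66*x^7 + 81*x^8
       + 55*x^9 + 54*x^10 + 27*x^11 + 19*x^12 + 6*x^13 + 3*x^14"
  \<comment> \<open>The numerator of the whole sum over the common denominator
    \<open>x * p^7 * h^3 * s * r\<close>. The 2 on the right later cancels the 2 under
    \<open>bmn_kappa\<close>.\<close>
  have poly: "x * p^7 * h^3 * s * r + m * x * p^6 * h^3 * (3 * s * x - x^2 - p^2 * h)
      - x^3 * m * s * c1 + m * s^2 * r * x * c1 + m * s^3 * r * W * h^2
      - m * s^4 * r * h^2 * (1 + 4 * x^2 + x^4) = 2 * x * s * P"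
    unfolding c1_def W_def P_def defs by algebra
  have "1 + coeff0 x / (1 - x^6) + coeff1 x / x / (1 - x^2)
       + coeff2 x / x * (1 + x^2) / (1 - x^2)^3
       + coeff3 x / x * (1 + 4 * x^2 + x^4) / (1 - x^2)^5 =
      (x * p^7 * h^3 * s * r + m * x * p^6 * h^3 * (3 * s * x - x^2 - p^2 * h)
      - x^3 * m * s * c1 + m * s^2 * r * x * c1 + m * s^3 * r * W * h^2
      - m * s^4 * r * h^2 * (1 + 4 * x^2 + x^4)) / (x * p^7 * h^3 * s * r)"
    unfolding t0 t1 t2 t3 using nz x(2) by (simp add: divide_simps) algebra
  also have "\<dots> = 2 * P / (p^7 * h^3 * r)"
    unfolding poly using nz x(2) by (simp add: divide_simps)
  finally have C: "1 + coeff0 x / (1 - x^6) + coeff1 x / x / (1 - x^2)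
       + coeff2 x / x * (1 + x^2) / (1 - x^2)^3
       + coeff3 x / x * (1 + 4 * x^2 + x^4) / (1 - x^2)^5 = 2 * P / (p^7 * h^3 * r)" .
  have kappa: "bmn_kappa x x x = p^3 / (m * s)"
  proof -
    have "bmn_kappa x x x = (1 - x^2)^3 / ((1 - x^3) * m^3)"
      by (simp add: bmn_kappa_def m_def power2_eq_square power3_eq_cube mult_ac)
    also have "\<dots> = p^3 / (m * s)"
      unfolding e2 e3 using nz by (simp add: divide_simps power_mult_distrib)
    finally show ?thesis .
  qed
  show ?thesis
    unfolding C kappa unfolding e4 e6 P_def[symmetric] m_def[symmetric]
    using nz by (simp add: divide_simps) algebra
qed

theorem mainTheorem1:
  fixes t :: complex
  assumes "norm t < 1"
  shows "bmn_index 2 (t^2) (t^2) (t^2) =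
    (1 - t^2)^3 *
    (1 + 3*t^2 + 12*t^4 + 20*t^6 + 42*t^8 + 48*t^10 + 75*t^12 + 66*t^14 + 81*t^16
       + 55*t^18 + 54*t^20 + 27*t^22 + 19*t^24 + 6*t^26 + 3*t^28) /
    ((1 - t^8)^3 * (1 - t^12))"
proof (cases "t = 0")
  case True
  \<comment> \<open>Mean 2 and \<open>bmn_kappa 0 0 0 = 1\<close> give index 1, as does the
    right-hand side at 0.\<close>
  show ?thesis
    using bmn_index_2_eq[OF has_circle_mean_bmn_factor_zero] True by (simp add: bmn_kappa_def)
next
  case False
  define x where "x = t^2"
  have x: "norm x < 1" "x \<noteq> 0"
    using False assms by (simp_all add: x_def norm_power power_less_one_iff)
  have pow: "t^4 = x^2" "t^6 = x^3" "t^8 = x^4" "t^10 = x^5" "t^12 = x^6" "t^14 = x^7"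
    "t^16 = x^8" "t^18 = x^9" "t^20 = x^10" "t^22 = x^11" "t^24 = x^12" "t^26 = x^13"
    "t^28 = x^14"
    by (simp_all add: x_def flip: power_mult)
  show ?thesis
    unfolding pow x_def[symmetric]
    by (rule trans[OF bmn_index_2_eq[OF has_circle_mean_bmn_factor[OF x]]
          index_rational_identity[OF x]])
qed

end
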